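(* There are exactly $84$ isomorphism classes of ternary $f$-quandles of order $3$, of which exactly $30$ are classes of ternary quandles, i.e. of ternary $f$-quandles whose twisting map is the identity.
   Context: A ternary $f$-quandle is a triple $(Q,T,\alpha)$ where $Q$ is a set, $T:Q\times Q\times Q\to Q$ is a ternary operation and $\alpha:Q\to Q$ is a morphism (i.e. $\alpha(T(x,y,z))=T(\alpha(x),\alpha(y),\alpha(z))$), called the twisting map, such that: (i) $T(T(x,y,z),\alpha(u),\alpha(v))=T(T(x,u,v),T(y,u,v),T(z,u,v))$ for all $x,y,z,u,v\in Q$; (ii) for all $a,b\in Q$, the map $R_{a,b}:Q\to Q$, $R_{a,b}(x)=T(x,a,b)$, is invertible; (iii) $T(x,x,x)=\alpha(x)$ for all $x\in Q$ (so $\alpha$ is determined by $T$). Its order is the cardinality of $Q$. An isomorphism from $(Q,T,\alpha)$ to $(Q',T',\alpha')$ is a bijection $\phi:Q\to Q'$ with $\phi(T(x,y,z))=T'(\phi(x),\phi(y),\phi(z))$ for all $x,y,z\in Q$. *)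

theory Defs
  imports Main
begin

locale ternary_f_quandle =
  fixes Q :: "'a set" and T :: "'a \<Rightarrow> 'a \<Rightarrow> 'a \<Rightarrow> 'a" and \<alpha> :: "'a \<Rightarrow> 'a"
  assumes T_closed: "\<lbrakk>x \<in> Q; y \<in> Q; z \<in> Q\<rbrakk> \<Longrightarrow> T x y z \<in> Q"
    and twist_closed: "x \<in> Q \<Longrightarrow> \<alpha> x \<in> Q"
    and twist_morphism:
      "\<lbrakk>x \<in> Q; y \<in> Q; z \<in> Q\<rbrakk> \<Longrightarrow> \<alpha> (T x y z) = T (\<alpha> x) (\<alpha> y) (\<alpha> z)"
    and distributive:
      "\<lbrakk>x \<in> Q; y \<in> Q; z \<in> Q; u \<in> Q; v \<in> Q\<rbrakk>
        \<Longrightarrow> T (T x y z) (\<alpha> u) (\<alpha> v) = T (T x u v) (T y u v) (T z u v)"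
    and right_invertible:
      "\<lbrakk>a \<in> Q; b \<in> Q\<rbrakk> \<Longrightarrow> bij_betw (\<lambda>x. T x a b) Q Q"
    and twisted_idempotent: "x \<in> Q \<Longrightarrow> T x x x = \<alpha> x"

locale ternary_quandle = ternary_f_quandle +
  assumes twist_id: "x \<in> Q \<Longrightarrow> \<alpha> x = x"

type_synonym 'a ternary_structure = "'a set \<times> ('a \<Rightarrow> 'a \<Rightarrow> 'a \<Rightarrow> 'a) \<times> ('a \<Rightarrow> 'a)"

definition ternary_f_quandles_of_order :: "nat \<Rightarrow> 'a ternary_structure set" where
  "ternary_f_quandles_of_order n = {(Q, T, \<alpha>). ternary_f_quandle Q T \<alpha> \<and> finite Q \<and> card Q = n}"

definition ternary_quandles_of_order :: "nat \<Rightarrow> 'a ternary_structure set" where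
  "ternary_quandles_of_order n = {(Q, T, \<alpha>). ternary_quandle Q T \<alpha> \<and> finite Q \<and> card Q = n}"

definition ternary_isomorphism ::
  "'a ternary_structure \<Rightarrow> 'b ternary_structure \<Rightarrow> ('a \<Rightarrow> 'b) \<Rightarrow> bool" where
  "ternary_isomorphism = (\<lambda>(Q, T, \<alpha>) (Q', T', \<alpha>') \<phi>. bij_betw \<phi> Q Q' \<and>
     (\<forall>x\<in>Q. \<forall>y\<in>Q. \<forall>z\<in>Q. \<phi> (T x y z) = T' (\<phi> x) (\<phi> y) (\<phi> z)))"

text \<open>
  Only the values of \<open>T\<close> and \<open>\<alpha>\<close> on the carrier matter. Triples that agree on their common carrier
  but differ outside it are isomorphic via the identity, so they are identified in the quotient below.
\<close>

definition isomorphic_of_order :: "nat \<Rightarrow> 'a ternary_structure rel" where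
  "isomorphic_of_order n = {(A, B). A \<in> ternary_f_quandles_of_order n \<and>
     B \<in> ternary_f_quandles_of_order n \<and> (\<exists>\<phi>. ternary_isomorphism A B \<phi>)}"

definition isomorphism_classes_of_order :: "nat \<Rightarrow> 'a ternary_structure set set" where
  "isomorphism_classes_of_order n = ternary_f_quandles_of_order n // isomorphic_of_order n"

lemma ternary_isomorphism_sym:
  assumes "ternary_f_quandle Q T \<alpha>" and "ternary_isomorphism (Q, T, \<alpha>) (Q', T', \<alpha>') \<phi>"
  shows "ternary_isomorphism (Q', T', \<alpha>') (Q, T, \<alpha>) (inv_into Q \<phi>)"
proof -
  interpret ternary_f_quandle Q T \<alpha> by fact
  have bij: "bij_betw \<phi> Q Q'"
    and hom: "\<And>x y z. \<lbrakk>x \<in> Q; y \<in> Q; z \<in> Q\<rbrakk> \<Longrightarrow> \<phi> (T x y z) = T' (\<phi> x) (\<phi> y) (\<phi> z)"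
    using assms(2) by (auto simp: ternary_isomorphism_def)
  let ?\<psi> = "inv_into Q \<phi>"
  have "?\<psi> (T' x y z) = T (?\<psi> x) (?\<psi> y) (?\<psi> z)" if "x \<in> Q'" "y \<in> Q'" "z \<in> Q'" for x y z
  proof -
    have mem: "?\<psi> x \<in> Q" "?\<psi> y \<in> Q" "?\<psi> z \<in> Q"
      using that bij by (metis bij_betw_apply bij_betw_inv_into)+
    have "T' x y z = \<phi> (T (?\<psi> x) (?\<psi> y) (?\<psi> z))"
      using that by (simp add: hom[OF mem] bij_betw_inv_into_right[OF bij])
    then show ?thesis
      using bij_betw_inv_into_left[OF bij] T_closed[OF mem] by simp
  qed
  with bij show ?thesis
    by (simp add: ternary_isomorphism_def bij_betw_inv_into)
qed

lemma equiv_isomorphic_of_order: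
  "equiv (ternary_f_quandles_of_order n) (isomorphic_of_order n :: 'a ternary_structure rel)"
proof (rule equivI)
  show "isomorphic_of_order n
      \<subseteq> ternary_f_quandles_of_order n \<times> (ternary_f_quandles_of_order n :: 'a ternary_structure set)"
    by (auto simp: isomorphic_of_order_def)
  have "ternary_isomorphism A A id" for A :: "'a ternary_structure"
    by (cases A) (simp add: ternary_isomorphism_def)
  then show "refl_on (ternary_f_quandles_of_order n)
      (isomorphic_of_order n :: 'a ternary_structure rel)"
    by (auto simp: refl_on_def isomorphic_of_order_def)
  show "sym (isomorphic_of_order n :: 'a ternary_structure rel)"
    unfolding sym_def isomorphic_of_order_def ternary_f_quandles_of_order_def
    using ternary_isomorphism_sym by fast
  have "ternary_isomorphism A C (\<psi> \<circ> \<phi>)"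
    if "ternary_isomorphism A B \<phi>" "ternary_isomorphism B C \<psi>"
    for A B C :: "'a ternary_structure" and \<phi> \<psi>
    using that
    by (cases A, cases B, cases C)
      (auto simp: ternary_isomorphism_def bij_betw_apply intro: bij_betw_trans)
  then show "trans (isomorphic_of_order n :: 'a ternary_structure rel)"
    unfolding trans_def isomorphic_of_order_def by blast
qed

end

theory Submission
  imports Defs
begin

text \<open>
  Every three-element structure can be transported to the fixed carrier \<open>UNIV :: point set\<close>, and
  it is determined up to isomorphism by the set \<open>models\<close> of all its transports. On the type
  \<open>point\<close> an operation is a total function, so there are no irrelevant values
  outside the carrier. The isomorphism classes over any type with at least three elements
  therefore correspond to the orbits of \<open>S\<^sub>3\<close> on the \<open>f\<close>-quandle operations
  on three points (\<open>card_isomorphism_classes\<close>, \<open>models_image_subset\<close>).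

  Relabelling the points conjugates the twisting map. Up to conjugacy there are seven self-maps of
  three points, so it suffices to fix the twisting map \<open>\<tau>\<close> to be one of the seven maps in
  \<open>twists\<close> and to add up the numbers of orbits; orbits for different representatives are distinct.
  For fixed \<open>\<tau>\<close> the operation is a \<open>3 \<times> 3\<close> array of permutations, the right
  multiplications \<open>R\<^bsub>u,v\<^esub>\<close>, and distributivity says that \<open>R\<^bsub>u,v\<^esub>\<close> and
  \<open>R\<^bsub>\<tau> u,\<tau> v\<^esub>\<close> together intertwine the operation with itself:
  \<open>R\<^bsub>\<tau> u,\<tau> v\<^esub> (T x y z) = T (R\<^bsub>u,v\<^esub> x) (R\<^bsub>u,v\<^esub> y) (R\<^bsub>u,v\<^esub> z)\<close>.
  Each instance of this involves few entries of the array, so a partially filled array can be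
  discarded as soon as one instance fails; a breadth-first search with this pruning lists exactly
  the \<open>f\<close>-quandles with twist \<open>\<tau>\<close> (\<open>set_search\<close>). Removing isomorphic
  tables from the lists leaves 30 classes for the identity, 27 for a transposition, 18 for a
  3-cycle, 9 for a constant map and none for a map with two values (\<open>class_counts\<close>). The sum
  is 84, and the 30 classes for the identity are the classes of ternary quandles.
\<close>

section \<open>Isomorphism classes as orbits of operations on three points\<close>

lemma ternary_isomorphism_trans:
  assumes "ternary_isomorphism A B \<phi>" and "ternary_isomorphism B C \<psi>"
  shows "ternary_isomorphism A C (\<psi> \<circ> \<phi>)"
  using assms
  by (cases A, cases B, cases C)
    (auto simp: ternary_isomorphism_def bij_betw_apply intro: bij_betw_trans)

lemma transport_f_quandle:
  assumes "ternary_f_quandle Q T \<alpha>" and bij: "bij_betw \<phi> Q Q'"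
  defines "g \<equiv> inv_into Q \<phi>"
  shows "ternary_f_quandle Q' (\<lambda>x y z. \<phi> (T (g x) (g y) (g z))) (\<lambda>x. \<phi> (\<alpha> (g x)))"
proof -
  interpret ternary_f_quandle Q T \<alpha> by fact
  have g: "g x \<in> Q" if "x \<in> Q'" for x
    using that bij unfolding g_def by (metis bij_betw_apply bij_betw_inv_into)
  have \<phi>: "\<phi> x \<in> Q'" if "x \<in> Q" for x
    using that bij by (rule bij_betw_apply[rotated])
  have g\<phi> [simp]: "g (\<phi> x) = x" if "x \<in> Q" for x
    using that bij unfolding g_def by (simp add: bij_betw_inv_into_left)
  show ?thesis
  proof
    fix a b assume "a \<in> Q'" "b \<in> Q'"
    then have "bij_betw (\<lambda>x. T x (g a) (g b)) Q Q"
      by (intro right_invertible g)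
    moreover have "bij_betw g Q' Q"
      unfolding g_def using bij by (rule bij_betw_inv_into)
    ultimately have "bij_betw (\<phi> \<circ> (\<lambda>x. T x (g a) (g b)) \<circ> g) Q' Q'"
      using bij by (intro bij_betw_trans)
    then show "bij_betw (\<lambda>x. \<phi> (T (g x) (g a) (g b))) Q' Q'"
      by (simp add: comp_def)
  qed (simp_all add: g \<phi> T_closed twist_closed twist_morphism distributive twisted_idempotent)
qed

text \<open>
  The two structures may live over different types. This makes the count independent of the ambient
  type and lets the type \<open>point\<close> stand for all three-element carriers.
\<close>

lemma isomorphic_copy:
  fixes A :: "'a ternary_structure"
  assumes A: "A \<in> ternary_f_quandles_of_order n"
    and S: "card (S :: 'b set) = n" and n: "0 < n"
  shows "\<exists>(B :: 'b ternary_structure) \<phi>.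
    B \<in> ternary_f_quandles_of_order n \<and> ternary_isomorphism A B \<phi> \<and>
    (A \<in> ternary_quandles_of_order n \<longrightarrow> B \<in> ternary_quandles_of_order n)"
proof -
  obtain Q T \<alpha> where A_eq: "A = (Q, T, \<alpha>)" by (cases A)
  have Q: "ternary_f_quandle Q T \<alpha>" "finite Q" "card Q = n"
    using A by (auto simp: A_eq ternary_f_quandles_of_order_def)
  interpret ternary_f_quandle Q T \<alpha> by (fact Q)
  have fin: "finite S" using S n by (simp add: card_ge_0_finite)
  with Q S obtain \<phi> where bij: "bij_betw \<phi> Q S"
    by (metis finite_same_card_bij)
  let ?g = "inv_into Q \<phi>"
  let ?T = "\<lambda>x y z. \<phi> (T (?g x) (?g y) (?g z))"
  let ?\<alpha> = "\<lambda>x. \<phi> (\<alpha> (?g x))"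
  have fq: "ternary_f_quandle S ?T ?\<alpha>"
    using Q(1) bij by (rule transport_f_quandle)
  have "?\<alpha> x = x" if "ternary_quandle Q T \<alpha>" "x \<in> S" for x
  proof -
    have "?g x \<in> Q"
      using that(2) bij by (metis bij_betw_apply bij_betw_inv_into)
    with ternary_quandle.twist_id[OF that(1)] that(2) bij show ?thesis
      by (simp add: bij_betw_inv_into_right)
  qed
  then have "ternary_quandle S ?T ?\<alpha>" if "ternary_quandle Q T \<alpha>"
    using that fq by (simp add: ternary_quandle_def ternary_quandle_axioms_def)
  moreover have "ternary_isomorphism A (S, ?T, ?\<alpha>) \<phi>"
    using bij by (simp add: A_eq ternary_isomorphism_def bij_betw_inv_into_left)
  ultimately have "(S, ?T, ?\<alpha>) \<in> ternary_f_quandles_of_order n \<and>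
      ternary_isomorphism A (S, ?T, ?\<alpha>) \<phi> \<and>
      (A \<in> ternary_quandles_of_order n \<longrightarrow> (S, ?T, ?\<alpha>) \<in> ternary_quandles_of_order n)"
    using fq fin S
    by (simp add: A_eq ternary_f_quandles_of_order_def ternary_quandles_of_order_def)
  then show ?thesis by blast
qed

datatype point = P0 | P1 | P2

lemma UNIV_point: "UNIV = {P0, P1, P2}"
  by (auto intro: point.exhaust)

lemma all_point: "(\<forall>x. P x) \<longleftrightarrow> P P0 \<and> P P1 \<and> P P2"
  by (metis point.exhaust)

instance point :: finite
  by standard (simp add: UNIV_point)

lemma card_point: "card (UNIV :: point set) = 3"
  by (simp add: UNIV_point)

type_synonym point_operation = "point \<Rightarrow> point \<Rightarrow> point \<Rightarrow> point"

text \<open>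
  The twisting map of an \<open>f\<close>-quandle is recovered from its operation by idempotence, so the
  operation alone is recorded. As a complete isomorphism invariant, \<open>models\<close> turns
  the quotient into the image of a function.
\<close>

definition models :: "'a ternary_structure \<Rightarrow> point_operation set" where
  "models A = {T. \<exists>h. ternary_isomorphism (UNIV, T, \<lambda>x. T x x x) A h}"

lemma models_eq:
  assumes "A \<in> ternary_f_quandles_of_order n" and iso: "ternary_isomorphism A B \<phi>"
  shows "models A = models B"
proof -
  obtain Q T \<alpha> where A: "A = (Q, T, \<alpha>)" by (cases A)
  obtain Q' T' \<alpha>' where B: "B = (Q', T', \<alpha>')" by (cases B)
  have "ternary_f_quandle Q T \<alpha>"
    using assms(1) by (auto simp: A ternary_f_quandles_of_order_def)
  then have "ternary_isomorphism B A (inv_into Q \<phi>)"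
    using iso unfolding A B by (rule ternary_isomorphism_sym)
  with iso show ?thesis
    unfolding models_def by (blast intro: ternary_isomorphism_trans)
qed

lemma point_structure_carrier:
  assumes "(Q, T, \<alpha>) \<in> ternary_f_quandles_of_order 3"
  shows "Q = (UNIV :: point set)"
proof -
  have "card Q = card (UNIV :: point set)"
    using assms by (simp add: ternary_f_quandles_of_order_def card_point)
  then show ?thesis by (intro card_subset_eq) simp_all
qed

lemma models_eq_iff:
  assumes A: "A \<in> ternary_f_quandles_of_order 3" and B: "B \<in> ternary_f_quandles_of_order 3"
  shows "models A = models B \<longleftrightarrow> (\<exists>\<phi>. ternary_isomorphism A B \<phi>)"
proof
  assume eq: "models A = models B"
  obtain P :: "point ternary_structure" and \<phi>
    where P: "P \<in> ternary_f_quandles_of_order 3" and \<phi>: "ternary_isomorphism A P \<phi>"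
    using isomorphic_copy[OF A card_point] by auto
  obtain Q T \<alpha> where "P = (Q, T, \<alpha>)" by (cases P)
  with P have P_eq: "P = (UNIV, T, \<alpha>)"
    using point_structure_carrier[of Q T \<alpha>] by simp
  have "ternary_isomorphism (UNIV, T, \<lambda>x. T x x x) P id"
    by (simp add: P_eq ternary_isomorphism_def)
  then have "T \<in> models P"
    unfolding models_def by blast
  also have "models P = models B"
    using models_eq[OF A \<phi>] eq by simp
  finally obtain h where "ternary_isomorphism (UNIV, T, \<lambda>x. T x x x) B h"
    unfolding models_def by blast
  then have "ternary_isomorphism P B h"
    by (cases B) (simp add: P_eq ternary_isomorphism_def)
  with \<phi> show "\<exists>\<phi>. ternary_isomorphism A B \<phi>"
    by (blast intro: ternary_isomorphism_trans)
qed (use models_eq[OF A] in blast)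

text \<open>
  Stated for a saturated subset \<open>B\<close> so that it serves both counts: all \<open>f\<close>-quandles,
  and those with trivial twist.
\<close>

lemma card_quotient_saturated:
  assumes r: "equiv A r" and "B \<subseteq> A" and sat: "\<And>x y. \<lbrakk>x \<in> B; (x, y) \<in> r\<rbrakk> \<Longrightarrow> y \<in> B"
    and f: "\<And>x y. \<lbrakk>x \<in> A; y \<in> A\<rbrakk> \<Longrightarrow> (x, y) \<in> r \<longleftrightarrow> f x = f y"
  shows "card {C \<in> A // r. C \<subseteq> B} = card (f ` B)"
proof -
  have "{C \<in> A // r. C \<subseteq> B} = (\<lambda>x. r `` {x}) ` B"
  proof safe
    fix C assume "C \<in> A // r" "C \<subseteq> B"
    moreover from this obtain x where "x \<in> A" "C = r `` {x}" by (auto elim: quotientE)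
    ultimately show "C \<in> (\<lambda>x. r `` {x}) ` B"
      using equiv_class_self[OF r] by blast
  qed (use assms(2) sat in \<open>auto intro: quotientI\<close>)
  moreover have "bij_betw (\<lambda>C. f (SOME x. x \<in> C)) ((\<lambda>x. r `` {x}) ` B) (f ` B)"
  proof -
    have rep: "f (SOME y. y \<in> r `` {x}) = f x" if "x \<in> B" for x
    proof -
      have "x \<in> A" using that assms(2) by blast
      then have "(SOME y. y \<in> r `` {x}) \<in> r `` {x}"
        using equiv_class_self[OF r] by (metis someI)
      moreover have "r \<subseteq> A \<times> A" using r by (simp add: equiv_def)
      ultimately show ?thesis using f[OF \<open>x \<in> A\<close>] by auto
    qed
    show ?thesis
    proof (rule bij_betw_imageI)
      show "inj_on (\<lambda>C. f (SOME x. x \<in> C)) ((\<lambda>x. r `` {x}) ` B)"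
      proof (rule inj_onI, clarify)
        fix x y assume "x \<in> B" "y \<in> B"
          and "f (SOME z. z \<in> r `` {x}) = f (SOME z. z \<in> r `` {y})"
        with rep have "f x = f y" by simp
        with \<open>x \<in> B\<close> \<open>y \<in> B\<close> f assms(2) have "(x, y) \<in> r" by blast
        then show "r `` {x} = r `` {y}" by (rule equiv_class_eq[OF r])
      qed
      show "(\<lambda>C. f (SOME x. x \<in> C)) ` (\<lambda>x. r `` {x}) ` B = f ` B"
        using rep by (simp add: image_image cong: image_cong)
    qed
  qed
  ultimately show ?thesis by (simp add: bij_betw_same_card)
qed

lemma quandles_subset: "ternary_quandles_of_order n \<subseteq> ternary_f_quandles_of_order n"
  by (auto simp: ternary_quandles_of_order_def ternary_f_quandles_of_order_def ternary_quandle_def)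

text \<open>
  An isomorphism carries \<open>T x x x\<close> to \<open>T' y y y\<close>, hence fixed points of one twisting map to
  fixed points of the other. Thus a class of \<open>f\<close>-quandles containing one quandle consists of
  quandles only.
\<close>

lemma quandles_saturated:
  assumes "A \<in> ternary_quandles_of_order n" and "(A, B) \<in> isomorphic_of_order n"
  shows "B \<in> ternary_quandles_of_order n"
proof -
  obtain Q T \<alpha> where A: "A = (Q, T, \<alpha>)" by (cases A)
  obtain Q' T' \<alpha>' where B: "B = (Q', T', \<alpha>')" by (cases B)
  have Q: "ternary_quandle Q T \<alpha>" and Q': "ternary_f_quandle Q' T' \<alpha>'" "finite Q'" "card Q' = n"
    using assms by (auto simp: A B ternary_quandles_of_order_def ternary_f_quandles_of_order_def
        isomorphic_of_order_def)
  interpret ternary_quandle Q T \<alpha> by fact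
  interpret Q': ternary_f_quandle Q' T' \<alpha>' by fact
  obtain \<phi> where bij: "bij_betw \<phi> Q Q'"
    and hom: "\<And>x y z. \<lbrakk>x \<in> Q; y \<in> Q; z \<in> Q\<rbrakk> \<Longrightarrow> \<phi> (T x y z) = T' (\<phi> x) (\<phi> y) (\<phi> z)"
    using assms(2) by (auto simp: A B isomorphic_of_order_def ternary_isomorphism_def)
  have "\<alpha>' y = y" if "y \<in> Q'" for y
  proof -
    obtain x where "x \<in> Q" "y = \<phi> x" using \<open>y \<in> Q'\<close> bij_betw_imp_surj_on[OF bij] by blast
    then show ?thesis
      using hom[of x x x] twisted_idempotent[of x] twist_id[of x] Q'.twisted_idempotent[OF that]
      by simp
  qed
  then show ?thesis
    using Q' by (simp add: B ternary_quandles_of_order_def ternary_quandle_def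
        ternary_quandle_axioms_def)
qed

lemma card_isomorphism_classes:
  fixes B :: "'a ternary_structure set"
  assumes "B \<subseteq> ternary_f_quandles_of_order 3"
    and "\<And>x y. \<lbrakk>x \<in> B; (x, y) \<in> isomorphic_of_order 3\<rbrakk> \<Longrightarrow> y \<in> B"
  shows "card {C \<in> isomorphism_classes_of_order 3. C \<subseteq> B} = card (models ` B)"
  unfolding isomorphism_classes_of_order_def
proof (rule card_quotient_saturated[OF equiv_isomorphic_of_order assms])
  show "(A, B) \<in> isomorphic_of_order 3 \<longleftrightarrow> models A = models B"
    if "A \<in> ternary_f_quandles_of_order 3" "B \<in> ternary_f_quandles_of_order 3"
    for A B :: "'a ternary_structure"
    using that by (simp add: models_eq_iff isomorphic_of_order_def)
qed

lemma models_image_subset: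
  assumes S: "card (S :: 'b set) = 3"
  shows "models ` (ternary_f_quandles_of_order 3 :: 'a ternary_structure set)
      \<subseteq> models ` (ternary_f_quandles_of_order 3 :: 'b ternary_structure set)"
    and "models ` (ternary_quandles_of_order 3 :: 'a ternary_structure set)
      \<subseteq> models ` (ternary_quandles_of_order 3 :: 'b ternary_structure set)"
proof -
  have copy: "\<exists>B :: 'b ternary_structure. B \<in> ternary_f_quandles_of_order 3 \<and> models A = models B \<and>
      (A \<in> ternary_quandles_of_order 3 \<longrightarrow> B \<in> ternary_quandles_of_order 3)"
    if "A \<in> ternary_f_quandles_of_order 3" for A :: "'a ternary_structure"
    using isomorphic_copy[OF that S] models_eq[OF that] by fastforce
  then show "models ` (ternary_f_quandles_of_order 3 :: 'a ternary_structure set)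
      \<subseteq> models ` (ternary_f_quandles_of_order 3 :: 'b ternary_structure set)"
    by (intro image_subsetI) (metis imageI)
  show "models ` (ternary_quandles_of_order 3 :: 'a ternary_structure set)
      \<subseteq> models ` (ternary_quandles_of_order 3 :: 'b ternary_structure set)"
  proof (rule image_subsetI)
    fix A :: "'a ternary_structure" assume A: "A \<in> ternary_quandles_of_order 3"
    then have "A \<in> ternary_f_quandles_of_order 3"
      using quandles_subset by blast
    from copy[OF this] A
    show "models A \<in> models ` (ternary_quandles_of_order 3 :: 'b ternary_structure set)"
      by auto
  qed
qed

section \<open>Tables\<close>

text \<open>
  Functions on \<open>point\<close> are represented by triples, so that the search below can be run by
  rewriting constructor terms.
\<close>

type_synonym 'b triple = "'b \<times> 'b \<times> 'b"

fun ap :: "'b triple \<Rightarrow> point \<Rightarrow> 'b" where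
  "ap (a, b, c) P0 = a"
| "ap (a, b, c) P1 = b"
| "ap (a, b, c) P2 = c"

fun upd :: "'b triple \<Rightarrow> point \<Rightarrow> 'b \<Rightarrow> 'b triple" where
  "upd (a, b, c) P0 d = (d, b, c)"
| "upd (a, b, c) P1 d = (a, d, c)"
| "upd (a, b, c) P2 d = (a, b, d)"

definition tab :: "(point \<Rightarrow> 'b) \<Rightarrow> 'b triple" where
  "tab f = (f P0, f P1, f P2)"

lemma ap_tab [simp]: "ap (tab f) = f"
  by (rule ext, rename_tac x, case_tac x) (simp_all add: tab_def)

lemma tab_ap [simp]: "tab (ap t) = t"
  by (cases t) (simp add: tab_def)

lemma ap_upd: "ap (upd t a d) b = (if b = a then d else ap t b)"
  by (cases t; cases a; cases b) auto

definition perms :: "point triple list" where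
  "perms = [(P0, P1, P2), (P0, P2, P1), (P1, P0, P2), (P1, P2, P0), (P2, P0, P1), (P2, P1, P0)]"

lemma set_perms: "set perms = {\<sigma>. bij (ap \<sigma>)}"
proof -
  have "\<sigma> \<in> set perms \<longleftrightarrow> inj (ap \<sigma>)" for \<sigma>
  proof -
    obtain a b c where \<sigma>: "\<sigma> = (a, b, c)" by (cases \<sigma>)
    have "inj (ap \<sigma>) \<longleftrightarrow> a \<noteq> b \<and> a \<noteq> c \<and> b \<noteq> c"
      by (auto simp: \<sigma> inj_on_def all_point)
    then show ?thesis
      by (cases a; cases b; cases c) (simp_all add: \<sigma> perms_def)
  qed
  moreover have "inj (ap \<sigma>) \<longleftrightarrow> bij (ap \<sigma>)" for \<sigma> :: "point triple"
    using finite_UNIV_inj_surj[of "ap \<sigma>"] by (auto simp: bij_def)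
  ultimately show ?thesis by auto
qed

text \<open>
  The entry for \<open>(a, b)\<close> is the right multiplication \<open>\<lambda>x. T x a b\<close>, the unit in which the
  search makes its choices; \<open>None\<close> marks an open choice.
\<close>

type_synonym partial_table = "point triple option triple triple"

definition entry :: "partial_table \<Rightarrow> point \<Rightarrow> point \<Rightarrow> point triple option" where
  "entry R a b = ap (ap R a) b"

definition fill :: "point \<Rightarrow> point \<Rightarrow> partial_table \<Rightarrow> point triple \<Rightarrow> partial_table" where
  "fill a b R r = upd R a (upd (ap R a) b (Some r))"

definition restriction :: "point_operation \<Rightarrow> (point \<times> point) set \<Rightarrow> partial_table" where
  "restriction T S =
    tab (\<lambda>a. tab (\<lambda>b. if (a, b) \<in> S then Some (tab (\<lambda>x. T x a b)) else None))"

abbreviation table :: "point_operation \<Rightarrow> partial_table" where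
  "table T \<equiv> restriction T UNIV"

lemma entry_restriction:
  "entry (restriction T S) a b = (if (a, b) \<in> S then Some (tab (\<lambda>x. T x a b)) else None)"
  by (simp add: entry_def restriction_def)

lemma entry_fill: "entry (fill a b R r) c d = (if (c, d) = (a, b) then Some r else entry R c d)"
  by (simp add: entry_def fill_def ap_upd)

lemma partial_table_eqI:
  assumes "\<And>a b. entry R a b = entry R' a b"
  shows "R = R'"
proof -
  have "ap (ap R a) = ap (ap R' a)" for a
    using assms by (auto simp: entry_def)
  then have "ap R = ap R'"
    by (metis ext tab_ap)
  then show ?thesis
    by (metis tab_ap)
qed

section \<open>Checking the axioms on a partial table\<close>

text \<open>
  The conditionals here and in the functions below play the part of conjunction and disjunction:
  the simplifier evaluates only the branch that is taken, so a failing test stops at its first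
  counterexample. The same square describes a distributivity instance (with \<open>r\<close>, \<open>s\<close>
  right multiplications) and an isomorphism (with \<open>r = s\<close>).
\<close>

fun square :: "point triple \<Rightarrow> point triple \<Rightarrow> point triple option \<Rightarrow> point triple option \<Rightarrow> bool"
  where
    "square r s (Some p) (Some q) =
      (if ap s (ap p P0) = ap q (ap r P0) then
        if ap s (ap p P1) = ap q (ap r P1) then ap s (ap p P2) = ap q (ap r P2) else False
       else False)"
  | "square r s None _ = True"
  | "square r s (Some p) None = True"

lemma square_iff:
  "square r s p q \<longleftrightarrow>
    (\<forall>p' q' x. p = Some p' \<longrightarrow> q = Some q' \<longrightarrow> ap s (ap p' x) = ap q' (ap r x))"
  by (cases "(r, s, p, q)" rule: square.cases) (auto simp: all_point)

fun squares ::
  "partial_table \<Rightarrow> partial_table \<Rightarrow> point triple option \<Rightarrow> point triple option \<Rightarrow>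
    (point \<times> point) list \<Rightarrow> bool" where
  "squares R R' (Some r) (Some s) [] = True"
| "squares R R' (Some r) (Some s) ((y, z) # l) =
    (if square r s (entry R y z) (entry R' (ap r y) (ap r z))
     then squares R R' (Some r) (Some s) l else False)"
| "squares R R' None _ l = True"
| "squares R R' (Some r) None l = True"

lemma squares_Some_iff:
  "squares R R' (Some r) (Some s) l \<longleftrightarrow>
    (\<forall>(y, z) \<in> set l. square r s (entry R y z) (entry R' (ap r y) (ap r z)))"
  by (induction l) (auto split: if_splits)

lemma squares_iff:
  "squares R R' r s l \<longleftrightarrow>
    (\<forall>r' s'. r = Some r' \<longrightarrow> s = Some s' \<longrightarrow> squares R R' (Some r') (Some s') l)"
  by (cases r; cases s) auto

text \<open>
  The search below works from the end of this list, so it fills the diagonal first, where the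
  twisting map leaves only two candidates per entry. The order
  affects only the size of the search tree.
\<close>

definition all_pairs :: "(point \<times> point) list" where
  "all_pairs = [(P2, P1), (P1, P2), (P2, P0), (P1, P0), (P0, P2), (P0, P1), (P2, P2), (P1, P1), (P0, P0)]"

lemma set_all_pairs: "set all_pairs = UNIV"
proof -
  have "p \<in> set all_pairs" for p
    by (cases p; cases "fst p"; cases "snd p") (simp_all add: all_pairs_def)
  then show ?thesis by blast
qed

fun viable_at :: "point triple \<Rightarrow> partial_table \<Rightarrow> (point \<times> point) list \<Rightarrow> bool" where
  "viable_at \<tau> R [] = True"
| "viable_at \<tau> R ((u, v) # l) =
    (if squares R R (entry R u v) (entry R (ap \<tau> u) (ap \<tau> v)) all_pairs
     then viable_at \<tau> R l else False)"

lemma viable_at_iff: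
  "viable_at \<tau> R l \<longleftrightarrow>
    (\<forall>(u, v) \<in> set l. squares R R (entry R u v) (entry R (ap \<tau> u) (ap \<tau> v)) all_pairs)"
  by (induction l) (auto split: if_splits)

definition viable :: "point triple \<Rightarrow> partial_table \<Rightarrow> bool" where
  "viable \<tau> R = viable_at \<tau> R all_pairs"

lemma viable_iff:
  "viable \<tau> R \<longleftrightarrow>
    (\<forall>u v r s y z p q x. entry R u v = Some r \<longrightarrow> entry R (ap \<tau> u) (ap \<tau> v) = Some s \<longrightarrow>
      entry R y z = Some p \<longrightarrow> entry R (ap r y) (ap r z) = Some q \<longrightarrow>
      ap s (ap p x) = ap q (ap r x))"
proof -
  have "viable \<tau> R \<longleftrightarrow>
      (\<forall>u v. squares R R (entry R u v) (entry R (ap \<tau> u) (ap \<tau> v)) all_pairs)"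
    by (simp add: viable_def viable_at_iff set_all_pairs)
  also have "\<dots> \<longleftrightarrow> (\<forall>u v r s. entry R u v = Some r \<longrightarrow> entry R (ap \<tau> u) (ap \<tau> v) = Some s \<longrightarrow>
      (\<forall>y z. square r s (entry R y z) (entry R (ap r y) (ap r z))))"
    by (subst squares_iff) (simp add: squares_Some_iff set_all_pairs)
  finally show ?thesis
    unfolding square_iff by blast
qed

definition f_quandles :: "point triple \<Rightarrow> point_operation set" where
  "f_quandles \<tau> = {T. ternary_f_quandle UNIV T (ap \<tau>)}"

text \<open>
  The morphism property of the twisting map is distributivity for three equal arguments:
  \<open>\<alpha> (T x y z) = T (T x y z) (T x y z) (T x y z) = T (T x x x) (\<alpha> y) (\<alpha> z)\<close>.
\<close>

lemma mem_f_quandles_iff: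
  "T \<in> f_quandles \<tau> \<longleftrightarrow>
    (\<forall>x. T x x x = ap \<tau> x) \<and> (\<forall>a b. bij (\<lambda>x. T x a b)) \<and>
    (\<forall>x y z u v. T (T x y z) (ap \<tau> u) (ap \<tau> v) = T (T x u v) (T y u v) (T z u v))"
proof safe
  assume idem: "\<forall>x. T x x x = ap \<tau> x" and bij: "\<forall>a b. bij (\<lambda>x. T x a b)"
    and dist: "\<forall>x y z u v. T (T x y z) (ap \<tau> u) (ap \<tau> v) = T (T x u v) (T y u v) (T z u v)"
  have "ap \<tau> (T x y z) = T (ap \<tau> x) (ap \<tau> y) (ap \<tau> z)" for x y z
    using idem dist[rule_format, of x x x y z] by simp
  with idem bij dist show "T \<in> f_quandles \<tau>"
    by (simp add: f_quandles_def ternary_f_quandle_def)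
qed (auto simp: f_quandles_def ternary_f_quandle_def)

lemma viable_table_iff:
  "viable \<tau> (table T) \<longleftrightarrow>
    (\<forall>x y z u v. T (T x y z) (ap \<tau> u) (ap \<tau> v) = T (T x u v) (T y u v) (T z u v))"
  by (auto simp: viable_iff entry_restriction)

text \<open>
  Pruning loses nothing: viability asks only for those instances of distributivity whose four
  entries are all known.
\<close>

lemma viable_restriction:
  assumes "T \<in> f_quandles \<tau>"
  shows "viable \<tau> (restriction T S)"
  unfolding viable_iff
proof (intro allI impI)
  fix u v r s y z p q x
  let ?R = "restriction T S"
  assume "entry ?R u v = Some r" "entry ?R (ap \<tau> u) (ap \<tau> v) = Some s"
    "entry ?R y z = Some p" "entry ?R (ap r y) (ap r z) = Some q"
  then have "tab (\<lambda>x. T x u v) = r" "tab (\<lambda>x. T x (ap \<tau> u) (ap \<tau> v)) = s"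
    "tab (\<lambda>x. T x y z) = p" "tab (\<lambda>x. T x (ap r y) (ap r z)) = q"
    by (simp_all add: entry_restriction split: if_splits)
  then show "ap s (ap p x) = ap q (ap r x)"
    using assms by (auto simp: mem_f_quandles_iff)
qed

section \<open>Exhaustive search\<close>

definition sends :: "point \<Rightarrow> point \<Rightarrow> point triple \<Rightarrow> bool" where
  "sends a c r \<longleftrightarrow> ap r a = c"

text \<open>
  Idempotence \<open>T a a a = \<tau> a\<close> concerns the diagonal entries one at a time, so it is imposed when
  they are chosen.
\<close>

definition columns :: "point triple \<Rightarrow> point \<Rightarrow> point \<Rightarrow> point triple list" where
  "columns \<tau> a b = (if a = b then filter (sends a (ap \<tau> a)) perms else perms)"

definition fillings :: "point triple \<Rightarrow> point \<Rightarrow> point \<Rightarrow> partial_table \<Rightarrow> partial_table list" where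
  "fillings \<tau> a b R = map (fill a b R) (columns \<tau> a b)"

fun search :: "point triple \<Rightarrow> (point \<times> point) list \<Rightarrow> partial_table list" where
  "search \<tau> [] = [((None, None, None), (None, None, None), (None, None, None))]"
| "search \<tau> ((a, b) # ps) = filter (viable \<tau>) (concat (map (fillings \<tau> a b) (search \<tau> ps)))"

lemma restriction_empty:
  "restriction T {} = ((None, None, None), (None, None, None), (None, None, None))"
  by (simp add: restriction_def tab_def)

lemma restriction_insert:
  "restriction T (insert (a, b) S) = fill a b (restriction T S) (tab (\<lambda>x. T x a b))"
  by (rule partial_table_eqI) (auto simp: entry_restriction entry_fill)

lemma mem_columns_iff:
  "r \<in> set (columns \<tau> a b) \<longleftrightarrow> bij (ap r) \<and> (a = b \<longrightarrow> ap r a = ap \<tau> a)"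
  by (auto simp: columns_def sends_def set_perms)

lemma search_complete:
  assumes T: "T \<in> f_quandles \<tau>"
  shows "restriction T (set ps) \<in> set (search \<tau> ps)"
proof (induction ps)
  case Nil
  show ?case by (simp add: restriction_empty)
next
  case (Cons p ps)
  obtain a b where p: "p = (a, b)" by (cases p)
  have "tab (\<lambda>x. T x a b) \<in> set (columns \<tau> a b)"
    using T by (simp add: mem_columns_iff mem_f_quandles_iff)
  with Cons have "restriction T (set (p # ps)) \<in> set (concat (map (fillings \<tau> a b) (search \<tau> ps)))"
    by (auto simp: p restriction_insert fillings_def)
  then show ?case
    using viable_restriction[OF T] by (simp add: p)
qed

text \<open>
  Viability is inspected only for the last filling; for a full table this is already all of
  distributivity. The empty list is excluded because its single result is never filtered.
\<close>

lemma search_sound: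
  assumes "R \<in> set (search \<tau> ps)"
  shows "\<exists>T. R = restriction T (set ps) \<and>
    (\<forall>(a, b) \<in> set ps. tab (\<lambda>x. T x a b) \<in> set (columns \<tau> a b)) \<and> (ps \<noteq> [] \<longrightarrow> viable \<tau> R)"
  using assms
proof (induction ps arbitrary: R)
  case Nil
  then show ?case by (simp add: restriction_empty)
next
  case (Cons p ps)
  obtain a b where p: "p = (a, b)" by (cases p)
  from Cons.prems obtain R0 r where R0: "R0 \<in> set (search \<tau> ps)"
    and r: "r \<in> set (columns \<tau> a b)" and R: "R = fill a b R0 r" and viable: "viable \<tau> R"
    by (auto simp: p fillings_def)
  from Cons.IH[OF R0] obtain T0 where T0: "R0 = restriction T0 (set ps)"
    "\<forall>(c, d) \<in> set ps. tab (\<lambda>x. T0 x c d) \<in> set (columns \<tau> c d)"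
    by blast
  define T where "T x c d = (if (c, d) = (a, b) then ap r x else T0 x c d)" for x c d
  have "R = restriction T (set (p # ps))"
    unfolding R T0 p
    by (rule partial_table_eqI) (auto simp: T_def entry_restriction entry_fill)
  moreover have "tab (\<lambda>x. T x c d) \<in> set (columns \<tau> c d)" if "(c, d) \<in> set (p # ps)" for c d
  proof (cases "(c, d) = (a, b)")
    case True
    with r show ?thesis by (simp add: T_def)
  next
    case False
    then have "(\<lambda>x. T x c d) = (\<lambda>x. T0 x c d)" "(c, d) \<in> set ps"
      using that by (auto simp: T_def p)
    with T0(2) show ?thesis by auto
  qed
  ultimately show ?case
    using viable by blast
qed

lemma set_search: "set (search \<tau> all_pairs) = table ` f_quandles \<tau>"
proof
  show "table ` f_quandles \<tau> \<subseteq> set (search \<tau> all_pairs)"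
    using search_complete[of _ \<tau> all_pairs] by (auto simp: set_all_pairs)
  show "set (search \<tau> all_pairs) \<subseteq> table ` f_quandles \<tau>"
  proof
    fix R assume "R \<in> set (search \<tau> all_pairs)"
    from search_sound[OF this] obtain T where "R = table T" "viable \<tau> (table T)"
      "\<And>a b. tab (\<lambda>x. T x a b) \<in> set (columns \<tau> a b)"
      by (auto simp: set_all_pairs) (auto simp: all_pairs_def)
    then show "R \<in> table ` f_quandles \<tau>"
      by (auto simp: mem_columns_iff mem_f_quandles_iff viable_table_iff)
  qed
qed

section \<open>Counting orbits\<close>

definition orbit :: "point_operation \<Rightarrow> point_operation set" where
  "orbit T = models (UNIV, T, \<lambda>x. T x x x)"

lemma models_point: "models (UNIV, T, \<alpha>) = orbit T"
  by (simp add: orbit_def models_def ternary_isomorphism_def)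

fun isomorphic_via :: "point triple list \<Rightarrow> partial_table \<Rightarrow> partial_table \<Rightarrow> bool" where
  "isomorphic_via [] R R' = False"
| "isomorphic_via (\<sigma> # \<sigma>s) R R' =
    (if squares R R' (Some \<sigma>) (Some \<sigma>) all_pairs then True else isomorphic_via \<sigma>s R R')"

lemma isomorphic_via_iff:
  "isomorphic_via \<sigma>s R R' \<longleftrightarrow> (\<exists>\<sigma> \<in> set \<sigma>s. squares R R' (Some \<sigma>) (Some \<sigma>) all_pairs)"
  by (induction \<sigma>s) auto

fun known :: "partial_table \<Rightarrow> partial_table list \<Rightarrow> bool" where
  "known R [] = False"
| "known R (R' # Rs) = (if isomorphic_via perms R R' then True else known R Rs)"

definition add_class :: "partial_table \<Rightarrow> partial_table list \<Rightarrow> partial_table list" where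
  "add_class R Rs = (if known R Rs then Rs else R # Rs)"

fun representatives :: "partial_table list \<Rightarrow> partial_table list" where
  "representatives [] = []"
| "representatives (R # Rs) = add_class R (representatives Rs)"

lemma known_iff: "known R Rs \<longleftrightarrow> (\<exists>R' \<in> set Rs. isomorphic_via perms R R')"
  by (induction Rs) auto

text \<open>
  Here \<open>f\<close> is any invariant that is complete on the given list.
\<close>

lemma card_image_representatives:
  assumes "\<And>R R'. \<lbrakk>R \<in> set Rs; R' \<in> set Rs\<rbrakk> \<Longrightarrow> isomorphic_via perms R R' \<longleftrightarrow> f R = f R'"
  shows "card (f ` set Rs) = length (representatives Rs)"
proof -
  have "set (representatives Rs) \<subseteq> set Rs \<and> f ` set (representatives Rs) = f ` set Rs \<and>
      distinct (map f (representatives Rs))"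
    using assms
  proof (induction Rs)
    case (Cons R Rs)
    then have IH: "set (representatives Rs) \<subseteq> set Rs"
      "f ` set (representatives Rs) = f ` set Rs" "distinct (map f (representatives Rs))"
      by auto
    have "known R (representatives Rs) \<longleftrightarrow> f R \<in> f ` set (representatives Rs)"
    proof -
      have "isomorphic_via perms R R' \<longleftrightarrow> f R = f R'" if "R' \<in> set (representatives Rs)" for R'
        using that IH(1) by (intro Cons.prems) auto
      then show ?thesis
        by (simp add: known_iff image_iff)
    qed
    then show ?case
      using IH by (auto simp: add_class_def)
  qed simp
  then show ?thesis
    by (metis distinct_card length_map set_map)
qed

lemma isomorphic_tables_iff:
  assumes "T \<in> f_quandles \<tau>" and "T' \<in> f_quandles \<tau>'"
  shows "orbit T = orbit T' \<longleftrightarrow>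
    (\<exists>\<sigma> \<in> set perms. \<forall>x y z. ap \<sigma> (T x y z) = T' (ap \<sigma> x) (ap \<sigma> y) (ap \<sigma> z))"
proof -
  have fq: "(UNIV, T, ap \<tau>) \<in> ternary_f_quandles_of_order 3"
    if "T \<in> f_quandles \<tau>" for T \<tau>
    using that by (simp add: ternary_f_quandles_of_order_def f_quandles_def card_point)
  have "orbit T = orbit T' \<longleftrightarrow>
      (\<exists>\<phi>. bij \<phi> \<and> (\<forall>x y z. \<phi> (T x y z) = T' (\<phi> x) (\<phi> y) (\<phi> z)))"
    using models_eq_iff[OF fq fq, OF assms] by (simp add: models_point ternary_isomorphism_def)
  also have "\<dots> \<longleftrightarrow> (\<exists>\<sigma> \<in> set perms. \<forall>x y z. ap \<sigma> (T x y z) = T' (ap \<sigma> x) (ap \<sigma> y) (ap \<sigma> z))"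
    (is "?L \<longleftrightarrow> ?R")
  proof
    assume ?L
    then obtain \<phi> where "bij \<phi>" "\<forall>x y z. \<phi> (T x y z) = T' (\<phi> x) (\<phi> y) (\<phi> z)" by blast
    then show ?R
      by (intro bexI[of _ "tab \<phi>"]) (simp_all add: set_perms)
  qed (auto simp: set_perms)
  finally show ?thesis .
qed

definition class_count :: "point triple \<Rightarrow> nat" where
  "class_count \<tau> = length (representatives (search \<tau> all_pairs))"

lemma card_orbits: "card (orbit ` f_quandles \<tau>) = class_count \<tau>"
proof -
  let ?f = "\<lambda>R. orbit (\<lambda>x a b. ap (the (entry R a b)) x)"
  have f: "?f (table T) = orbit T" for T
    by (simp add: entry_restriction)
  have "isomorphic_via perms R R' \<longleftrightarrow> ?f R = ?f R'"
    if R: "R \<in> set (search \<tau> all_pairs)" "R' \<in> set (search \<tau> all_pairs)" for R R'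
  proof -
    obtain T T' where T: "R = table T" "T \<in> f_quandles \<tau>" "R' = table T'" "T' \<in> f_quandles \<tau>"
      using R by (auto simp: set_search)
    show ?thesis
      unfolding T f isomorphic_tables_iff[OF T(2,4)] isomorphic_via_iff squares_Some_iff square_iff
      by (auto simp: set_all_pairs entry_restriction)
  qed
  then have "card (?f ` set (search \<tau> all_pairs)) = class_count \<tau>"
    unfolding class_count_def by (rule card_image_representatives)
  then show ?thesis
    by (simp add: set_search image_image f)
qed

text \<open>
  The identity, a transposition, a 3-cycle, a constant map, and the three conjugacy classes of maps
  with two values, which act on their image as the identity, as a constant map or as a swap.
\<close>

definition twists :: "point triple list" where
  "twists = [(P0, P1, P2), (P0, P2, P1), (P1, P2, P0), (P0, P0, P0),
     (P0, P0, P2), (P0, P0, P1), (P1, P0, P0)]"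

lemma twist_normal_form:
  "\<exists>\<sigma> \<in> set perms. \<exists>\<tau> \<in> set twists. \<forall>x. ap \<sigma> (\<alpha> x) = ap \<tau> (ap \<sigma> x)"
  by (cases "\<alpha> P0"; cases "\<alpha> P1"; cases "\<alpha> P2") (simp_all add: all_point perms_def twists_def)

lemma twists_not_conjugate:
  assumes "\<tau> \<in> set twists" "\<tau>' \<in> set twists" "\<tau> \<noteq> \<tau>'" "\<sigma> \<in> set perms"
  shows "\<not> (\<forall>x. ap \<sigma> (ap \<tau> x) = ap \<tau>' (ap \<sigma> x))"
proof -
  have "\<forall>\<tau> \<in> set twists. \<forall>\<tau>' \<in> set twists. \<forall>\<sigma> \<in> set perms.
      \<tau> = \<tau>' \<or> \<not> square \<sigma> \<sigma> (Some \<tau>) (Some \<tau>')"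
    by code_simp
  with assms show ?thesis
    by (auto simp: square_iff)
qed

lemma models_point_structures:
  "models ` (ternary_f_quandles_of_order 3 :: point ternary_structure set)
    = (\<Union>\<tau> \<in> set twists. orbit ` f_quandles \<tau>)"
proof
  show "models ` (ternary_f_quandles_of_order 3 :: point ternary_structure set)
      \<subseteq> (\<Union>\<tau> \<in> set twists. orbit ` f_quandles \<tau>)"
  proof (rule image_subsetI)
    fix A :: "point ternary_structure" assume A: "A \<in> ternary_f_quandles_of_order 3"
    obtain Q T \<alpha> where "A = (Q, T, \<alpha>)" by (cases A)
    with A have A_eq: "A = (UNIV, T, \<alpha>)"
      using point_structure_carrier[of Q T \<alpha>] by simp
    obtain \<sigma> \<tau> where \<sigma>: "\<sigma> \<in> set perms" and \<tau>: "\<tau> \<in> set twists"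
      and conj: "\<And>x. ap \<sigma> (\<alpha> x) = ap \<tau> (ap \<sigma> x)"
      using twist_normal_form by metis
    have bij: "bij (ap \<sigma>)" using \<sigma> by (simp add: set_perms)
    define g where "g = inv (ap \<sigma>)"
    have g: "g (ap \<sigma> x) = x" "ap \<sigma> (g x) = x" for x
      using bij by (simp_all add: g_def bij_is_inj bij_is_surj surj_f_inv_f)
    let ?T = "\<lambda>x y z. ap \<sigma> (T (g x) (g y) (g z))"
    have "ternary_f_quandle UNIV T \<alpha>"
      using A by (simp add: A_eq ternary_f_quandles_of_order_def)
    from transport_f_quandle[OF this bij]
    have "ternary_f_quandle UNIV ?T (\<lambda>x. ap \<tau> x)"
      by (simp add: conj g flip: g_def)
    then have "?T \<in> f_quandles \<tau>"
      by (simp add: f_quandles_def)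
    moreover have "ternary_isomorphism A (UNIV, ?T, ap \<tau>) (ap \<sigma>)"
      using bij by (simp add: A_eq ternary_isomorphism_def g)
    then have "models A = orbit ?T"
      using models_eq[OF A] models_point by metis
    ultimately show "models A \<in> (\<Union>\<tau> \<in> set twists. orbit ` f_quandles \<tau>)"
      using \<tau> by blast
  qed
  have "orbit T \<in> models ` (ternary_f_quandles_of_order 3 :: point ternary_structure set)"
    if "T \<in> f_quandles \<tau>" for T \<tau>
    using that
    by (intro image_eqI[of _ _ "(UNIV, T, ap \<tau>)"])
      (simp_all add: models_point ternary_f_quandles_of_order_def f_quandles_def card_point)
  then show "(\<Union>\<tau> \<in> set twists. orbit ` f_quandles \<tau>)
      \<subseteq> models ` (ternary_f_quandles_of_order 3 :: point ternary_structure set)"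
    by blast
qed

lemma models_point_quandles:
  "models ` (ternary_quandles_of_order 3 :: point ternary_structure set)
    = orbit ` f_quandles (P0, P1, P2)"
proof
  have id: "ap (P0, P1, P2) = (\<lambda>x. x)"
    by (rule ext, rename_tac x, case_tac x) simp_all
  show "models ` (ternary_quandles_of_order 3 :: point ternary_structure set)
      \<subseteq> orbit ` f_quandles (P0, P1, P2)"
  proof (rule image_subsetI)
    fix A :: "point ternary_structure" assume A: "A \<in> ternary_quandles_of_order 3"
    obtain Q T \<alpha> where "A = (Q, T, \<alpha>)" by (cases A)
    moreover have "A \<in> ternary_f_quandles_of_order 3"
      using A quandles_subset by blast
    ultimately have A_eq: "A = (UNIV, T, \<alpha>)"
      using point_structure_carrier[of Q T \<alpha>] by simp
    with A have T: "ternary_f_quandle UNIV T \<alpha>" "\<And>x. \<alpha> x = x"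
      by (auto simp: ternary_quandles_of_order_def ternary_quandle_def ternary_quandle_axioms_def)
    then have "\<alpha> = ap (P0, P1, P2)" by (simp add: id fun_eq_iff)
    with T have "T \<in> f_quandles (P0, P1, P2)"
      by (simp add: f_quandles_def)
    then show "models A \<in> orbit ` f_quandles (P0, P1, P2)"
      by (simp add: A_eq models_point)
  qed
  have "orbit T \<in> models ` (ternary_quandles_of_order 3 :: point ternary_structure set)"
    if "T \<in> f_quandles (P0, P1, P2)" for T
    using that
    by (intro image_eqI[of _ _ "(UNIV, T, ap (P0, P1, P2))"])
      (simp_all add: models_point ternary_quandles_of_order_def ternary_quandle_def
        ternary_quandle_axioms_def f_quandles_def card_point id)
  then show "orbit ` f_quandles (P0, P1, P2)
      \<subseteq> models ` (ternary_quandles_of_order 3 :: point ternary_structure set)"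
    by blast
qed

text \<open>
  The lists of tables found have 63, 27, 18, 12, 0, 0 and 0 members.
\<close>

lemma class_counts: "map class_count twists = [30, 27, 18, 9, 0, 0, 0]"
  by code_simp

lemma card_all_orbits: "card (\<Union>\<tau> \<in> set twists. orbit ` f_quandles \<tau>) = 84"
proof -
  have disjoint: "orbit ` f_quandles \<tau> \<inter> orbit ` f_quandles \<tau>' = {}"
    if "\<tau> \<in> set twists" "\<tau>' \<in> set twists" "\<tau> \<noteq> \<tau>'" for \<tau> \<tau>'
  proof -
    have "orbit T \<noteq> orbit T'" if T: "T \<in> f_quandles \<tau>" "T' \<in> f_quandles \<tau>'" for T T'
    proof
      assume "orbit T = orbit T'"
      then obtain \<sigma> where \<sigma>: "\<sigma> \<in> set perms"
        and hom: "\<And>x y z. ap \<sigma> (T x y z) = T' (ap \<sigma> x) (ap \<sigma> y) (ap \<sigma> z)"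
        using isomorphic_tables_iff[OF T] by blast
      have "ap \<sigma> (ap \<tau> x) = ap \<tau>' (ap \<sigma> x)" for x
        using hom[of x x x] T by (simp add: mem_f_quandles_iff)
      then show False
        using twists_not_conjugate[OF \<open>\<tau> \<in> _\<close> \<open>\<tau>' \<in> _\<close> \<open>\<tau> \<noteq> \<tau>'\<close> \<sigma>] by blast
    qed
    then show ?thesis by blast
  qed
  have "card (\<Union>\<tau> \<in> set twists. orbit ` f_quandles \<tau>) = (\<Sum>\<tau> \<in> set twists. class_count \<tau>)"
    using disjoint by (subst card_UN_disjoint) (simp_all add: card_orbits)
  also have "\<dots> = sum_list (map class_count twists)"
    by (rule sum_list_distinct_conv_sum_set[symmetric]) (simp add: twists_def)
  also have "\<dots> = 84"
    by (simp add: class_counts)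
  finally show ?thesis .
qed

theorem mainTheorem4:
  assumes "\<exists>S :: 'a set. card S = 3"
  shows "card (isomorphism_classes_of_order 3 :: 'a ternary_structure set set) = 84 \<and>
    card {C \<in> (isomorphism_classes_of_order 3 :: 'a ternary_structure set set).
            C \<subseteq> ternary_quandles_of_order 3} = 30"
proof
  from assms obtain S :: "'a set" where S: "card S = 3" by blast
  let ?F = "ternary_f_quandles_of_order 3 :: 'a ternary_structure set"
  let ?K = "ternary_quandles_of_order 3 :: 'a ternary_structure set"
  let ?C = "isomorphism_classes_of_order 3 :: 'a ternary_structure set set"
  have "{C \<in> ?C. C \<subseteq> ?F} = ?C"
    unfolding isomorphism_classes_of_order_def
    using in_quotient_imp_subset[OF equiv_isomorphic_of_order] by blast
  moreover have "card {C \<in> ?C. C \<subseteq> ?F} = card (models ` ?F)"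
    by (rule card_isomorphism_classes) (auto simp: isomorphic_of_order_def)
  moreover have "models ` ?F = (\<Union>\<tau> \<in> set twists. orbit ` f_quandles \<tau>)"
    unfolding models_point_structures[symmetric]
    by (intro subset_antisym models_image_subset(1)[OF S] models_image_subset(1)[OF card_point])
  ultimately show "card ?C = 84"
    by (simp add: card_all_orbits)
  have "card {C \<in> ?C. C \<subseteq> ?K} = card (models ` ?K)"
    using quandles_subset quandles_saturated by (rule card_isomorphism_classes)
  also have "models ` ?K = orbit ` f_quandles (P0, P1, P2)"
    unfolding models_point_quandles[symmetric]
    by (intro subset_antisym models_image_subset(2)[OF S] models_image_subset(2)[OF card_point])
  also have "card \<dots> = 30"
    using class_counts by (simp add: card_orbits twists_def)
  finally show "card {C \<in> ?C. C \<subseteq> ?K} = 30" .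
qed

end
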